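(* Let $\mathfrak X$ be the set of all triples $(A,B,C)\in\mathbb Z^3$ with $A+B+C=0$, $\gcd(A,B,C)=1$ and $ABC\neq0$. For $(A,B,C)\in\mathfrak X$ let $H(A,B,C)=\max\{|A|,|B|,|C|\}$, $S(A,B,C)=P^+(ABC)$, and let $\mathcal I(A,B,C)$ be the insulator of the integer $ABC$. Suppose that for every $\delta>0$ only finitely many $(A,B,C)\in\mathfrak X$ satisfy $\log H(A,B,C)>\delta\,S(A,B,C)$. Then $\mathcal I$ is a semi-height on $\mathfrak X$, i.e. for every real $X>0$ the set $\{(A,B,C)\in\mathfrak X:\mathcal I(A,B,C)<X\}$ is finite.
   Context: For a non-zero integer $n$, $P^+(n)$ is the largest prime divisor of $n$ (with $P^+(\pm1)=1$). A non-zero integer $n$ is called insulated if every prime $p\le P^+(n)$ divides $n$; the insulator of $n$ is the smallest positive integer $m$ such that $n\cdot m$ is insulated. A semi-height on $\mathfrak X$ is a function $h:\mathfrak X\to\mathbb R$ such that $\{(A,B,C)\in\mathfrak X:h(A,B,C)<X\}$ is finite for every real $X>0$. *)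

theory Defs
  imports Complex_Main "HOL-Computational_Algebra.Primes"
begin

(* Meaningful for n \<noteq> 0 only: the set of primes dividing 0 is infinite. *)
definition P_plus :: "int \<Rightarrow> int" where
  "P_plus n = (if \<bar>n\<bar> = 1 then 1 else Max {p. prime p \<and> p dvd n})"

definition insulated :: "int \<Rightarrow> bool" where
  "insulated n \<longleftrightarrow> n \<noteq> 0 \<and> (\<forall>p. prime p \<and> p \<le> P_plus n \<longrightarrow> p dvd n)"

definition insulator :: "int \<Rightarrow> nat" where
  "insulator n = (LEAST m. 0 < m \<and> insulated (n * int m))"

definition abc_triples :: "(int \<times> int \<times> int) set" where
  "abc_triples = {(A, B, C). A + B + C = 0 \<and> Gcd {A, B, C} = 1 \<and> A * B * C \<noteq> 0}"

definition triple_height :: "int \<times> int \<times> int \<Rightarrow> int" where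
  "triple_height = (\<lambda>(A, B, C). Max {\<bar>A\<bar>, \<bar>B\<bar>, \<bar>C\<bar>})"

definition triple_smoothness :: "int \<times> int \<times> int \<Rightarrow> int" where
  "triple_smoothness = (\<lambda>(A, B, C). P_plus (A * B * C))"

definition triple_insulator :: "int \<times> int \<times> int \<Rightarrow> nat" where
  "triple_insulator = (\<lambda>(A, B, C). insulator (A * B * C))"

definition semi_height_on :: "'a set \<Rightarrow> ('a \<Rightarrow> real) \<Rightarrow> bool" where
  "semi_height_on T h \<longleftrightarrow> (\<forall>X>0. finite {t \<in> T. h t < X})"

end

theory Submission
  imports Defs "HOL-Library.Discrete_Functions" "HOL-Real_Asymp.Real_Asymp"
begin

text \<open>
  Every prime up to \<open>S = P\<^sup>+(ABC)\<close> divides \<open>ABC\<close> times its insulator, so the primorial of \<open>S\<close> is at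
  most \<open>H\<^sup>3\<close> times the insulator. By Chebyshev's lower bound the primorial is at least \<open>exp (S/2)\<close>
  for large \<open>S\<close>. If the insulator is less than \<open>X\<close> and \<open>ln H \<le> S/12\<close> (which, by hypothesis, only
  finitely many triples violate), this gives \<open>S/2 \<le> S/4 + ln X\<close>, which bounds \<open>S\<close>, hence \<open>H\<close>.

  Chebyshev's bound comes from the divisibility of \<open>lcm(1, \<dots>, n)\<close> by all binomial coefficients
  \<open>n choose k\<close>, which gives \<open>2\<^sup>n \<le> (n + 1) lcm(1, \<dots>, n)\<close>, while only primes up to \<open>\<surd>n\<close> occur in
  the lcm with exponent greater than one.
\<close>

section \<open>Lcm of 1, ..., n and Chebyshev's lower bound for the primorial\<close>

lemma Leibniz_harmonic_triangle:
  assumes "1 \<le> k" "k \<le> n"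
  shows "1 / (real (Suc k) * real (Suc n choose Suc k)) =
    1 / (real k * real (n choose k)) - 1 / (real k * real (Suc n choose k))"
proof -
  \<comment> \<open>The absorption identities \<open>a\<close> and \<open>b\<close> share the right
    side \<open>Suc n * (n choose k)\<close>, which ties the three binomials of the claim
    together.\<close>
  have a: "real (Suc k) * real (Suc n choose Suc k) = real (Suc n) * real (n choose k)"
    by (metis Suc_times_binomial_eq mult.commute of_nat_mult)
  have b: "real (Suc n choose k) * (real (Suc n) - real k) = real (Suc n) * real (n choose k)"
  proof -
    have "(Suc n - k) * (Suc n choose k) = Suc n * (n choose k)"
      using binomial_absorb_comp[of "Suc n" k] by simp
    then show ?thesis
      using assms by (metis le_SucI mult.commute of_nat_diff of_nat_mult)
  qed
  have pos: "real (n choose k) > 0" "real (Suc n choose k) > 0" "real k > 0"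
    using assms by (auto simp: zero_less_binomial_iff simp del: binomial_Suc_Suc)
  have "1 / (real k * real (n choose k)) - 1 / (real k * real (Suc n choose k)) =
    (real (Suc n choose k) - real (n choose k)) /
      (real k * real (n choose k) * real (Suc n choose k))"
    using pos by (simp add: field_simps del: binomial_Suc_Suc)
  also have "real (n choose k) =
      real (Suc n choose k) * (real (Suc n) - real k) / real (Suc n)"
    using b by (simp add: field_simps)
  then have "real (Suc n choose k) - real (n choose k) =
      real (Suc n choose k) * real k / real (Suc n)"
    by (simp add: field_simps del: binomial_Suc_Suc)
  also have "real (Suc n choose k) * real k / real (Suc n) /
      (real k * real (n choose k) * real (Suc n choose k)) =
      1 / (real (Suc n) * real (n choose k))"
    using pos by (simp add: divide_simps del: binomial_Suc_Suc)
  finally show ?thesis unfolding a by simp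
qed

text \<open>Induction on \<open>k\<close>, for all rows at once: the harmonic triangle writes an
  entry of column \<open>Suc k\<close> as a difference of two entries of column \<open>k\<close>, in
  rows \<open>n - 1\<close> and \<open>n\<close>. Keeping \<open>N\<close> apart from
  \<open>n\<close> lets the same lcm serve both rows.\<close>

lemma Lcm_div_binomial_in_Ints:
  assumes "n \<le> N" "1 \<le> k" "k \<le> n"
  shows "real (Lcm {1..N}) / (real k * real (n choose k)) \<in> \<int>"
  using assms(2,3,1)
proof (induction k arbitrary: n rule: dec_induct)
  case base
  then have "n dvd Lcm {1..N}" by (intro dvd_Lcm) auto
  then show ?case by (auto elim!: dvdE)
next
  case (step k)
  from step.prems obtain m where m: "n = Suc m" "k \<le> m" by (cases n) auto
  have "real (Lcm {1..N}) / (real (Suc k) * real (n choose Suc k)) =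
      real (Lcm {1..N}) * (1 / (real (Suc k) * real (Suc m choose Suc k)))"
    by (simp add: m)
  also have "\<dots> = real (Lcm {1..N}) / (real k * real (m choose k)) -
      real (Lcm {1..N}) / (real k * real (n choose k))"
    unfolding Leibniz_harmonic_triangle[OF step.hyps(1) m(2)] m(1) by (simp add: right_diff_distrib)
  also have "\<dots> \<in> \<int>"
    using step.IH[of m] step.IH[of n] step.prems m by (intro Ints_diff) auto
  finally show ?case .
qed

lemma Lcm_atLeastAtMost_pos: "Lcm {1..n} > (0::nat)"
  by (rule gr0I) (simp add: Lcm_0_iff)

text \<open>A positive integer quotient is at least 1, and the extra factor \<open>k\<close> can
  only help. Outside \<open>1 \<le> k \<le> n\<close> the coefficient is 0 or 1.\<close>

lemma binomial_le_Lcm: "n choose k \<le> Lcm {1..n}"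
proof (cases "1 \<le> k \<and> k \<le> n")
  case True
  have bin: "n choose k > 0" using True by (simp add: zero_less_binomial_iff)
  let ?q = "real (Lcm {1..n}) / (real k * real (n choose k))"
  have "?q > 0" using Lcm_atLeastAtMost_pos[of n] bin True by simp
  moreover have "?q \<in> \<int>" using Lcm_div_binomial_in_Ints[of n n k] True by blast
  then obtain z where "?q = of_int z" by (rule Ints_cases)
  ultimately have "?q \<ge> 1" by (metis of_int_0_less_iff of_int_1_le_iff int_one_le_iff_zero_less)
  then have "real k * real (n choose k) \<le> real (Lcm {1..n})"
    using bin True by (subst (asm) le_divide_eq_1_pos) auto
  then have "k * (n choose k) \<le> Lcm {1..n}"
    by (metis of_nat_le_iff of_nat_mult)
  moreover have "n choose k \<le> k * (n choose k)" using True by simp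
  ultimately show ?thesis by linarith
next
  case False
  with Lcm_atLeastAtMost_pos[of n] show ?thesis by (cases "k = 0") (auto simp: Suc_le_eq binomial_eq_0)
qed

lemma two_power_le_Lcm: "2 ^ n \<le> Suc n * Lcm {1..n}"
proof -
  have "2 ^ n = (\<Sum>k\<le>n. n choose k)" by (simp add: choose_row_sum)
  also have "\<dots> \<le> (\<Sum>k\<le>n. Lcm {1..n})" by (intro sum_mono binomial_le_Lcm)
  finally show ?thesis by simp
qed

text \<open>The exponent of a prime in an lcm is the maximum of its exponents in the arguments, so a
  prime power, unlike a general divisor, already divides one of them. This caps the prime powers in
  \<open>Lcm {1..n}\<close> by \<open>n\<close>.\<close>

lemma prime_power_dvd_LcmE:
  fixes p :: nat
  assumes "prime p" "p ^ k dvd Lcm {1..n}" "n > 0"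
  obtains i where "i \<in> {1..n}" "p ^ k dvd i"
proof -
  have "\<exists>i\<in>{1..n}. p ^ k dvd i" using assms(3,2)
  proof (induction n rule: nat_induct_non_zero)
    case (Suc n)
    have "p ^ k dvd lcm (Suc n) (Lcm {1..n})"
      using Suc.prems by (simp add: atLeastAtMostSuc_conv)
    moreover have "Lcm {1..n} \<noteq> (0::nat)" using Lcm_atLeastAtMost_pos[of n] by simp
    ultimately have "p ^ k dvd Suc n \<or> p ^ k dvd Lcm {1..n}"
      using assms(1) by (simp add: power_dvd_iff_le_multiplicity multiplicity_lcm 
        lcm_eq_0_iff prime_nat_iff max_def split: if_splits del: One_nat_def)
    then show ?case using Suc.IH by (auto simp: atLeastAtMostSuc_conv)
  qed auto
  then show ?thesis using that by blast
qed

lemma Lcm_le_primorial: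
  assumes "n > 0"
  shows "Lcm {1..n} \<le> n ^ floor_sqrt n * \<Prod>{p. prime p \<and> p \<le> n}"
proof -
  let ?L = "Lcm {1..n}" and ?P = "{p. prime p \<and> p \<le> n}"
  have fin: "finite ?P" by simp
  have le: "p ^ multiplicity p ?L \<le> n" if pr: "prime p" for p :: nat
  proof -
    obtain i where i: "i \<in> {1..n}" "p ^ multiplicity p ?L dvd i"
      using prime_power_dvd_LcmE[OF pr multiplicity_dvd assms] .
    then have "p ^ multiplicity p ?L \<le> i" by (intro dvd_imp_le) auto
    with i show ?thesis by simp
  qed
  have sub: "prime_factors ?L \<subseteq> ?P"
  proof safe
    fix p assume p: "p \<in> prime_factors ?L"
    then show pr: "prime p" by auto
    have "multiplicity p ?L > 0"
      using p by (simp add: prime_factors_multiplicity)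
    then have "p ^ 1 \<le> p ^ multiplicity p ?L"
      using prime_gt_0_nat[OF pr] by (intro power_increasing) auto
    with le[OF pr] show "p \<le> n" by simp
  qed
  have "?L = (\<Prod>p\<in>prime_factors ?L. p ^ multiplicity p ?L)"
    by (rule prime_factorization_nat[OF Lcm_atLeastAtMost_pos])
  \<comment> \<open>One factor \<open>p\<close> is split off each prime power to build the
    primorial. What remains is bounded crudely by \<open>n\<close> for the few primes with
    \<open>p^2 \<le> n\<close>, and by 1 for the others, whose exponent is below 2.\<close>
  also have "\<dots> \<le> (\<Prod>p\<in>prime_factors ?L. (if p\<^sup>2 \<le> n then n else 1) * p)"
  proof (intro prod_mono conjI)
    fix p assume "p \<in> prime_factors ?L"
    then have pr: "prime p" by auto
    show "p ^ multiplicity p ?L \<le> (if p\<^sup>2 \<le> n then n else 1) * p"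
    proof (cases "p\<^sup>2 \<le> n")
      case True
      have "n \<le> n * p" using prime_gt_0_nat[OF pr] by simp
      with le[OF pr] have "p ^ multiplicity p ?L \<le> n * p" by (rule order_trans)
      with True show ?thesis by simp
    next
      case False
      then have "p ^ multiplicity p ?L < p ^ 2" using le[OF pr] by linarith
      then have "multiplicity p ?L < 2"
        using prime_gt_1_nat[OF pr] power_less_imp_less_exp by blast
      then have "p ^ multiplicity p ?L \<le> p ^ 1"
        using prime_gt_0_nat[OF pr] by (intro power_increasing) auto
      with False show ?thesis by simp
    qed
  qed auto
  \<comment> \<open>The product over a subset divides the full product, which is positive.\<close>
  also have "\<dots> \<le> (\<Prod>p\<in>?P. (if p\<^sup>2 \<le> n then n else 1) * p)"
    using assms
    by (intro dvd_imp_le[OF prod_dvd_prod_subset[OF fin sub]] prod_pos) (auto simp: prime_gt_0_nat)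
  also have "\<dots> = (\<Prod>p\<in>?P. if p\<^sup>2 \<le> n then n else 1) * \<Prod>?P"
    by (simp add: prod.distrib)
  also have "(\<Prod>p\<in>?P. if p\<^sup>2 \<le> n then n else 1) = n ^ card {p\<in>?P. p\<^sup>2 \<le> n}"
    by (simp add: prod.If_cases Int_def)
  also have "\<dots> \<le> n ^ floor_sqrt n"
  proof (intro power_increasing)
    have "{p\<in>?P. p\<^sup>2 \<le> n} \<subseteq> {1..floor_sqrt n}"
      by (auto simp: le_floor_sqrt_iff Suc_le_eq prime_gt_0_nat)
    from card_mono[OF _ this] show "card {p\<in>?P. p\<^sup>2 \<le> n} \<le> floor_sqrt n" by simp
  qed (use assms in auto)
  finally show ?thesis by simp
qed

lemma ln_primorial_ge:
  assumes "n > 0"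
  shows "real n * ln 2 - ln (real n + 1) - sqrt (real n) * ln (real n)
    \<le> ln (real (\<Prod>{p::nat. prime p \<and> p \<le> n}))"
proof -
  let ?P = "\<Prod>{p::nat. prime p \<and> p \<le> n}"
  have P: "?P > 0" by (auto intro!: prod_pos simp: prime_gt_0_nat)
  have "2 ^ n \<le> Suc n * (n ^ floor_sqrt n * ?P)"
    using mult_le_mono2[OF Lcm_le_primorial[OF assms]] by (rule order_trans[OF two_power_le_Lcm])
  then have "real (2 ^ n) \<le> real (Suc n * (n ^ floor_sqrt n * ?P))"
    unfolding of_nat_le_iff .
  then have "(2::real) ^ n \<le> (real n + 1) * (real n ^ floor_sqrt n * real ?P)"
    by (simp add: algebra_simps)
  then have "ln ((2::real) ^ n) \<le> ln ((real n + 1) * (real n ^ floor_sqrt n * real ?P))"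
    by (subst ln_le_cancel_iff) (use assms P in \<open>simp_all del: of_nat_prod\<close>)
  also have "\<dots> = ln (real n + 1) + real (floor_sqrt n) * ln (real n) + ln (real ?P)"
    using assms P by (simp add: ln_mult ln_realpow del: of_nat_prod)
  also have "ln ((2::real) ^ n) = real n * ln 2" by (simp add: ln_realpow)
  finally have "real n * ln 2 \<le> ln (real n + 1) + real (floor_sqrt n) * ln (real n) + ln (real ?P)" .
  moreover have "real (floor_sqrt n) \<le> sqrt (real n)"
    by (metis floor_sqrt_power2_le of_nat_le_iff of_nat_power real_le_rsqrt)
  then have "real (floor_sqrt n) * ln (real n) \<le> sqrt (real n) * ln (real n)"
    using assms by (intro mult_right_mono) auto
  ultimately show ?thesis by linarith
qed

text \<open>A rational bound strictly above 1/2, leaving \<open>n / 12\<close> to absorb the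
  sublinear error terms of \<open>ln_primorial_ge\<close>. It arises as 1/4 + 1/3, from
  \<open>ln x \<ge> 1 - 1/x\<close> at 4/3 and 3/2.\<close>

lemma ln_2_ge: "7 / 12 \<le> ln (2::real)"
proof -
  have "ln (2::real) = ln (4/3) + ln (3/2)" using ln_mult[of "4/3::real" "3/2"] by simp
  moreover have "ln (4/3) \<ge> 1 - 1 / (4/3::real)" "ln (3/2) \<ge> 1 - 1 / (3/2::real)"
    using ln_le_minus_one[of "3/4::real"] ln_le_minus_one[of "2/3::real"] by (simp_all add: ln_div)
  ultimately show ?thesis by simp
qed

lemma eventually_primorial_ge:
  "eventually (\<lambda>n. real n / 2 \<le> ln (real (\<Prod>{p::nat. prime p \<and> p \<le> n}))) at_top"
proof -
  have "eventually (\<lambda>x::real. x / 2 \<le> x * (7/12) - ln (x + 1) - sqrt x * ln x) at_top"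
    by real_asymp
  then have "eventually (\<lambda>n. real n / 2 \<le>
      real n * (7/12) - ln (real n + 1) - sqrt (real n) * ln (real n)) at_top"
    using filterlim_real_sequentially by (rule eventually_compose_filterlim)
  with eventually_gt_at_top[of 0] show ?thesis
  proof eventually_elim
    case (elim n)
    have "real n * (7/12) \<le> real n * ln 2" using ln_2_ge by (intro mult_left_mono) auto
    with elim ln_primorial_ge[of n] show ?case by linarith
  qed
qed

section \<open>Largest prime factors and insulators\<close>

lemma finite_prime_divisors_int:
  fixes n :: int
  assumes "n \<noteq> 0"
  shows "finite {p. prime p \<and> p dvd n}"
  using assms finite_divisors_int[of n] by (rule_tac finite_subset[of _ "{d. d dvd n}"]) auto

lemma prime_dvd_le_P_plus:
  assumes "n \<noteq> 0" "prime p" "p dvd n"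
  shows "p \<le> P_plus n"
proof -
  have "\<bar>n\<bar> \<noteq> 1" using assms by (metis abs_dvd_iff dvd_abs_iff not_prime_unit)
  then show ?thesis
    using assms finite_prime_divisors_int[OF assms(1)] by (auto simp: P_plus_def)
qed

lemma P_plus_cases:
  assumes "n \<noteq> 0"
  shows "P_plus n = 1 \<or> (prime (P_plus n) \<and> P_plus n dvd n)"
proof (cases "\<bar>n\<bar> = 1")
  case False
  then have "\<not> is_unit n" by simp
  then obtain p where "prime p" "p dvd n"
    using assms prime_divisor_exists by blast
  then have "Max {p. prime p \<and> p dvd n} \<in> {p. prime p \<and> p dvd n}"
    using finite_prime_divisors_int[OF assms] by (intro Max_in) auto
  then show ?thesis using False by (simp add: P_plus_def)
qed (simp add: P_plus_def)

lemma P_plus_ge_1: "n \<noteq> 0 \<Longrightarrow> P_plus n \<ge> 1"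
  using P_plus_cases[of n] prime_ge_1_int[of "P_plus n"] by auto

lemma P_plus_le_mult:
  assumes "n * m \<noteq> 0"
  shows "P_plus n \<le> P_plus (n * m)"
  using P_plus_cases[of n] P_plus_ge_1[OF assms] assms
    prime_dvd_le_P_plus[OF assms, of "P_plus n"] by auto

text \<open>Ensures that the \<open>LEAST\<close> in \<open>insulator\<close> is attained. The
  witness is the primorial of \<open>P_plus n\<close>: it supplies all primes up to that bound and
  brings in none above it, so the bound does not move.\<close>

lemma insulated_multiple_exists:
  assumes "n \<noteq> 0"
  shows "\<exists>m>0. insulated (n * int m)"
proof -
  let ?P = "{p. prime p \<and> p \<le> nat (P_plus n)}"
  let ?m = "\<Prod>?P"
  have m: "?m > 0" by (auto intro!: prod_pos simp: prime_gt_0_nat)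
  have nm: "n * int ?m \<noteq> 0" using assms m by (simp del: of_nat_prod)
  have P: "P_plus (n * int ?m) \<le> P_plus n"
  proof (cases "P_plus (n * int ?m) = 1")
    case True
    then show ?thesis using P_plus_ge_1[OF assms] by simp
  next
    case False
    define q where "q = P_plus (n * int ?m)"
    from False P_plus_cases[OF nm] have q: "prime q" "q dvd n * int ?m" by (auto simp: q_def)
    then consider "q dvd n" | "q dvd int ?m" using prime_dvd_multD by blast
    then have "q \<le> P_plus n"
    proof cases
      case 1
      then show ?thesis using prime_dvd_le_P_plus assms q(1) by blast
    next
      case 2
      then obtain p where p: "p \<in> ?P" "q dvd int p"
        using q(1) by (auto simp: prime_dvd_prod_iff)
      then have "q \<le> int p" by (intro zdvd_imp_le) (auto simp: prime_gt_0_nat)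
      with p(1) P_plus_ge_1[OF assms] show ?thesis by auto
    qed
    then show ?thesis by (simp add: q_def)
  qed
  have "p dvd n * int ?m" if p: "prime p" "p \<le> P_plus (n * int ?m)" for p
  proof -
    have "nat p \<in> ?P" using p P by auto
    then have "nat p dvd ?m" by (intro dvd_prodI) auto
    then have "int (nat p) dvd int ?m" unfolding of_nat_dvd_iff .
    then show ?thesis using p(1) by (simp add: prime_ge_0_int del: of_nat_prod)
  qed
  with nm m show ?thesis unfolding insulated_def by blast
qed

lemma prod_primes_dvd:
  fixes n :: nat
  assumes "finite A" "\<And>p. p \<in> A \<Longrightarrow> prime p \<and> p dvd n"
  shows "\<Prod>A dvd n"
  using assms
proof (induction A rule: finite_induct)
  case (insert p A)
  have "coprime p (\<Prod>A)"
    by (rule prod_coprime_right) (use insert in \<open>metis insertCI primes_coprime\<close>)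
  with insert show ?case by (simp add: divides_mult)
qed simp

text \<open>Passing to the insulated multiple cannot lower \<open>P_plus\<close>, so every prime up
  to \<open>P_plus n\<close> divides that multiple. Distinct primes are coprime, hence their product
  divides it as well.\<close>

lemma primorial_le_insulator:
  assumes "n \<noteq> 0"
  shows "\<Prod>{p. prime p \<and> p \<le> nat (P_plus n)} \<le> nat \<bar>n\<bar> * insulator n"
proof -
  let ?P = "{p. prime p \<and> p \<le> nat (P_plus n)}"
  have I: "insulator n > 0" "insulated (n * int (insulator n))"
    using LeastI_ex[OF insulated_multiple_exists[OF assms]] by (auto simp: insulator_def)
  have dvd: "p dvd nat \<bar>n\<bar> * insulator n" if "p \<in> ?P" for p
  proof -
    have "n * int (insulator n) \<noteq> 0" using I assms by simp
    from P_plus_le_mult[OF this] that P_plus_ge_1[OF assms]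
    have "int p \<le> P_plus (n * int (insulator n))" by auto
    with I(2) that have "int p dvd n * int (insulator n)" unfolding insulated_def by auto
    then have "nat \<bar>int p\<bar> dvd nat \<bar>n * int (insulator n)\<bar>"
      by (metis dvd_abs_iff int_dvd_int_iff abs_of_nat nat_int nat_abs_dvd_iff nat_0_le abs_ge_zero)
    then show ?thesis by (simp add: abs_mult nat_mult_distrib)
  qed
  have "\<Prod>?P dvd nat \<bar>n\<bar> * insulator n"
    by (rule prod_primes_dvd) (use dvd in auto)
  then show ?thesis using assms I by (intro dvd_imp_le) auto
qed

section \<open>Heights of triples and the finiteness argument\<close>

lemma finite_triple_height_le: "finite {t. triple_height t \<le> K}"
proof (rule finite_subset)
  show "{t. triple_height t \<le> K} \<subseteq> {-K..K} \<times> {-K..K} \<times> {-K..K}"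
    by (auto simp: triple_height_def)
qed auto

lemma abs_prod_le_triple_height:
  "\<bar>A * B * C\<bar> \<le> triple_height (A, B, C) ^ 3"
proof -
  let ?H = "triple_height (A, B, C)"
  have "\<bar>A\<bar> \<le> ?H" "\<bar>B\<bar> \<le> ?H" "\<bar>C\<bar> \<le> ?H" by (auto simp: triple_height_def)
  then have "\<bar>A\<bar> * \<bar>B\<bar> * \<bar>C\<bar> \<le> ?H * ?H * ?H" by (intro mult_mono) auto
  then show ?thesis by (simp add: abs_mult power3_eq_cube)
qed

theorem theorem4p2:
  assumes "\<And>\<delta>::real. \<delta> > 0 \<Longrightarrow>
    finite {t \<in> abc_triples.
      ln (real_of_int (triple_height t)) > \<delta> * real_of_int (triple_smoothness t)}"
  shows "semi_height_on abc_triples (\<lambda>t. real (triple_insulator t))"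
  unfolding semi_height_on_def
proof (intro allI impI)
  fix X :: real
  assume X: "X > 0"
  \<comment> \<open>With \<open>\<delta> = 1/12\<close>, the cube of the height costs at most
    \<open>3 * S/12 = S/4\<close> outside \<open>?E\<close>, half of Chebyshev's
    \<open>S/2\<close>.\<close>
  let ?E = "{t \<in> abc_triples.
    ln (real_of_int (triple_height t)) > 1/12 * real_of_int (triple_smoothness t)}"
  obtain N where N: "\<And>n. n \<ge> N \<Longrightarrow> real n / 2 \<le> ln (real (\<Prod>{p::nat. prime p \<and> p \<le> n}))"
    using eventually_primorial_ge by (auto simp: eventually_at_top_linorder)
  \<comment> \<open>\<open>K\<close> bounds \<open>S\<close> outside \<open>?E\<close>: either
    \<open>S < N\<close>, or \<open>S/2 \<le> S/4 + ln X\<close>. The height is then at most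
    \<open>exp (K/12)\<close>; being an integer, it can be compared with the floor.\<close>
  define K where "K = max (real N) (4 * ln X)"
  have "{t \<in> abc_triples. real (triple_insulator t) < X} \<subseteq>
      ?E \<union> {t. triple_height t \<le> \<lfloor>exp (K / 12)\<rfloor>}"
  proof (intro subsetI UnCI)
    fix t
    assume t: "t \<in> {t \<in> abc_triples. real (triple_insulator t) < X}"
      and "t \<notin> {t. triple_height t \<le> \<lfloor>exp (K / 12)\<rfloor>}"
    then have large: "exp (K / 12) < real_of_int (triple_height t)"
      by (simp add: le_floor_iff)
    obtain A B C where t_eq: "t = (A, B, C)" by (cases t)
    define n where "n = A * B * C"
    define S where "S = nat (P_plus n)"
    define H where "H = real_of_int (triple_height t)"
    define \<Pi> where "\<Pi> = real (\<Prod>{p::nat. prime p \<and> p \<le> S})"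
    have n: "n \<noteq> 0" using t by (auto simp: t_eq n_def abc_triples_def)
    have S: "real_of_int (triple_smoothness t) = real S"
      using P_plus_ge_1[OF n] by (simp add: t_eq triple_smoothness_def n_def S_def)
    have H: "H > 0" using large exp_gt_zero[of "K / 12"] unfolding H_def by linarith
    have K: "K / 12 < ln H" using large H by (metis H_def exp_less_cancel_iff exp_ln)
    have \<Pi>: "\<Pi> > 0" unfolding \<Pi>_def by (auto intro!: prod_pos simp: prime_gt_0_nat)
    have "\<Pi> \<le> real (nat \<bar>n\<bar> * insulator n)"
      unfolding \<Pi>_def S_def of_nat_le_iff by (rule primorial_le_insulator[OF n])
    also have "\<dots> = real_of_int \<bar>n\<bar> * real (insulator n)" by simp
    also have "\<dots> \<le> H ^ 3 * X"
    proof (intro mult_mono)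
      show "real_of_int \<bar>n\<bar> \<le> H ^ 3"
        using abs_prod_le_triple_height[of A B C] unfolding H_def t_eq n_def
        by (metis of_int_le_iff of_int_power)
      show "real (insulator n) \<le> X"
        using t by (simp add: t_eq triple_insulator_def n_def)
    qed (use H in auto)
    finally have "ln \<Pi> \<le> ln (H ^ 3 * X)"
      using \<Pi> H X by (subst ln_le_cancel_iff) auto
    then have ln_\<Pi>: "ln \<Pi> \<le> 3 * ln H + ln X"
      using H X by (simp add: ln_mult ln_realpow)
    \<comment> \<open>Otherwise \<open>S \<le> K\<close>, so \<open>ln H \<le> K/12\<close>, against
      the assumed large height.\<close>
    have "ln H > 1/12 * real S"
    proof (rule ccontr)
      assume "\<not> ?thesis"
      then have le: "ln H \<le> real S / 12" by simp
      have "real S \<le> K"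
      proof (cases "S \<ge> N")
        case True
        with N[OF True] ln_\<Pi> le show ?thesis by (simp add: \<Pi>_def K_def)
      qed (simp add: K_def)
      with le K show False by simp
    qed
    then show "t \<in> ?E" using t S by (simp add: H_def)
  qed
  then show "finite {t \<in> abc_triples. real (triple_insulator t) < X}"
    by (rule finite_subset) (use assms[of "1/12"] finite_triple_height_le in simp)
qed

end
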